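(* Let $\mathcal R=\langle R\mid \nu,\mu\rangle$ be an $(m_r,n_r)$-ring, let $\mathsf G=\langle G\mid\mu_{\mathsf G}\rangle$ be an $n_g$-ary group, and let $S$ be the set of formal sums with coefficients in $R$ and basis $G$. Let $\ell_n,\ell_g\ge1$, and let the multiplication of the polyadic group ring, an operation $\boldsymbol\mu:S^N\to S$ of arity $N$, be given by the convolution with polyadic powers $\ell_n$ and $\ell_g$, that is $$\boldsymbol\mu\Big[\sum_{g} r_g(1)\bullet g,\ldots,\sum_g r_g(N)\bullet g\Big]=\sum_{g_1\in G}\cdots\sum_{g_N\in G}\mu^{\circ\ell_n}\big[r_{g_1}(1),\ldots,r_{g_N}(N)\big]\bullet\mu_{\mathsf G}^{\circ\ell_g}\big[g_1,\ldots,g_N\big],$$ where each of the $N$ factors contributes exactly one argument to $\mu^{\circ\ell_n}$ and exactly one argument to $\mu_{\mathsf G}^{\circ\ell_g}$. Then $$N=\ell_n(n_r-1)+1=\ell_g(n_g-1)+1 .$$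
   Context: All arities are integers $\ge 2$. An $n$-ary operation $\mu:X^n\to X$ is totally associative if, for all $x_1,\dots,x_{2n-1}\in X$, the value $\mu[x_1,\dots,x_{i-1},\mu[x_i,\dots,x_{i+n-1}],x_{i+n},\dots,x_{2n-1}]$ does not depend on $i\in\{1,\dots,n\}$; then $\langle X\mid\mu\rangle$ is an $n$-ary semigroup. For $\ell\ge1$, $\mu^{\circ\ell}$ denotes the $\ell$-fold composition of $\mu$ with itself (it contains $\ell$ copies of $\mu$; by associativity the bracketing is irrelevant); it takes exactly $\ell(n-1)+1$ arguments. An $n$-ary group is an $n$-ary semigroup in which (for $n\ge3$) every $x$ has a querelement $\bar x$, i.e. $\mu[\bar x,x,\dots,x]=x$ with $\bar x$ in any of the $n$ positions; for $n=2$ it is an ordinary group. An $(m_r,n_r)$-ring $\langle R\mid\nu,\mu\rangle$ is a set with an $m_r$-ary addition $\nu$ making $R$ a commutative $m_r$-ary group, and an $n_r$-ary multiplication $\mu$ making $R$ an $n_r$-ary semigroup, such that $\mu$ distributes over $\nu$ in each of its $n_r$ arguments. A polyadic zero of $\mathcal R$, if it exists, is an element $z_R\in R$ with $\nu[r,z_R,\dots,z_R]=r$ for all $r$ and with $\mu[r_1,\dots,r_{n_r}]=z_R$ whenever some $r_i=z_R$. Formal sums: an element of $S$ is a formal sum $\sum_{g\in G}r_g\bullet g$, i.e. a family $(r_g)_{g\in G}$ of elements of $R$. If $\mathcal R$ has a polyadic zero $z_R$, all but finitely many $r_g$ are required to equal $z_R$ (and such terms may be omitted); if $\mathcal R$ has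 no polyadic zero, $G$ is finite and all families are allowed. In a product of formal sums, the coefficients of terms with the same group element $u$ are gathered into one coefficient by an iterate of $\nu$ (when $z_R$ exists, terms with coefficient $z_R$ may be added or dropped so that the number of summands becomes of the form $\ell(m_r-1)+1$; when there is no polyadic zero it is assumed, so that the product is defined, that for every $u\in G$ the number of $N$-tuples with product $u$ has the form $\ell(m_r-1)+1$ with $\ell\ge0$). *)

theory Defs
  imports
    "HOL-Algebra.Group"
    "HOL-Library.FuncSet"
    "HOL-Library.Multiset"
    "HOL-Library.NList"
begin

section \<open>Polyadic structures\<close>

text \<open>
  An $n$-ary operation on a carrier \<open>X\<close> is a function on lists, of which only the values on
  \<open>nlists n X\<close> (the lists of length \<open>n\<close> over \<open>X\<close>) matter.
\<close>

locale nary_operation =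
  fixes X :: "'a set" and n :: nat and f :: "'a list \<Rightarrow> 'a"
  assumes arity_ge_2: "2 \<le> n"
    and closed: "xs \<in> nlists n X \<Longrightarrow> f xs \<in> X"

text \<open>As usual, the underlying set of an algebraic structure is nonempty.\<close>

locale nary_semigroup = nary_operation +
  assumes nonempty: "X \<noteq> {}"
    and total_assoc: "\<lbrakk>xs \<in> nlists (2 * n - 1) X; i < n; j < n\<rbrakk> \<Longrightarrow>
      f (take i xs @ f (take n (drop i xs)) # drop (i + n) xs) =
      f (take j xs @ f (take n (drop j xs)) # drop (j + n) xs)"

locale nary_group = nary_semigroup +
  assumes binary_group: "n = 2 \<Longrightarrow>
      \<exists>e. group \<lparr>carrier = X, monoid.mult = (\<lambda>x y. f [x, y]), one = e\<rparr>"
    and querelement: "\<lbrakk>n \<ge> 3; x \<in> X\<rbrakk> \<Longrightarrow>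
      \<exists>q\<in>X. \<forall>i<n. f ((replicate n x)[i := q]) = x"

locale polyadic_ring =
  add: nary_group R m \<nu> + mult: nary_semigroup R n \<mu>
  for R :: "'r set" and m :: nat and \<nu> :: "'r list \<Rightarrow> 'r"
    and n :: nat and \<mu> :: "'r list \<Rightarrow> 'r" +
  assumes add_commute: "\<lbrakk>xs \<in> nlists m R; ys \<in> nlists m R; mset xs = mset ys\<rbrakk> \<Longrightarrow> \<nu> xs = \<nu> ys"
    and distrib: "\<lbrakk>xs \<in> nlists n R; ys \<in> nlists m R; i < n\<rbrakk> \<Longrightarrow>
      \<mu> (xs[i := \<nu> ys]) = \<nu> (map (\<lambda>y. \<mu> (xs[i := y])) ys)"

definition polyadic_zero ::
  "'r set \<Rightarrow> nat \<Rightarrow> ('r list \<Rightarrow> 'r) \<Rightarrow> nat \<Rightarrow> ('r list \<Rightarrow> 'r) \<Rightarrow> 'r \<Rightarrow> bool" where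
  "polyadic_zero R m \<nu> n \<mu> z \<longleftrightarrow> z \<in> R \<and>
     (\<forall>r\<in>R. \<nu> (r # replicate (m - 1) z) = r) \<and>
     (\<forall>rs\<in>nlists n R. z \<in> set rs \<longrightarrow> \<mu> rs = z)"

text \<open>
  The \<open>l\<close>-fold composition of an $n$-ary operation with itself, bracketed to the left. It is a
  partial function on lists: the value is \<open>None\<close> when the arguments do not fill exactly the places
  of the \<open>l\<close> copies of \<open>f\<close>. The composition of zero copies is the identity, which takes a single
  argument.
\<close>

fun polyadic_power :: "nat \<Rightarrow> ('a list \<Rightarrow> 'a) \<Rightarrow> nat \<Rightarrow> 'a list \<Rightarrow> 'a option" where
  "polyadic_power n f 0 xs = (case xs of [x] \<Rightarrow> Some x | _ \<Rightarrow> None)"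
| "polyadic_power n f (Suc l) xs =
     (if length xs < n then None else polyadic_power n f l (f (take n xs) # drop n xs))"


section \<open>Formal sums and their convolution\<close>

text \<open>
  A formal sum is its family of coefficients, extended by \<open>undefined\<close> outside \<open>G\<close>. A polyadic zero
  is unique if it exists, so that the quantifier over \<open>z\<close> covers both the case with a zero and
  the case without one.
\<close>

definition formal_sums ::
  "'r set \<Rightarrow> nat \<Rightarrow> ('r list \<Rightarrow> 'r) \<Rightarrow> nat \<Rightarrow> ('r list \<Rightarrow> 'r) \<Rightarrow> 'g set \<Rightarrow> ('g \<Rightarrow> 'r) set" where
  "formal_sums R m \<nu> n \<mu> G =
     {r \<in> G \<rightarrow>\<^sub>E R. \<forall>z. polyadic_zero R m \<nu> n \<mu> z \<longrightarrow> finite {g \<in> G. r g \<noteq> z}}"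

text \<open>
  \<open>gathers_to R m \<nu> n \<mu> T c y\<close>: an iterate of \<open>\<nu>\<close> gathers the coefficients \<open>c t\<close>, for \<open>t \<in> T\<close>,
  into the single coefficient \<open>y\<close>. If there is a zero, coefficients equal to it may be dropped and
  further zeros appended. If there is none, \<open>T\<close> is enumerated completely, so its cardinality is
  forced to be an admissible number of summands, $k(m-1)+1$ with $k\ge0$.
\<close>

definition gathers_to ::
  "'r set \<Rightarrow> nat \<Rightarrow> ('r list \<Rightarrow> 'r) \<Rightarrow> nat \<Rightarrow> ('r list \<Rightarrow> 'r) \<Rightarrow> 't set \<Rightarrow> ('t \<Rightarrow> 'r) \<Rightarrow> 'r \<Rightarrow> bool" where
  "gathers_to R m \<nu> n \<mu> T c y \<longleftrightarrow>
     (if \<exists>z. polyadic_zero R m \<nu> n \<mu> z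
      then \<exists>z ts j k. polyadic_zero R m \<nu> n \<mu> z \<and>
             distinct ts \<and> set ts \<subseteq> T \<and> (\<forall>t \<in> T - set ts. c t = z) \<and>
             polyadic_power m \<nu> k (map c ts @ replicate j z) = Some y
      else \<exists>ts k. distinct ts \<and> set ts = T \<and> polyadic_power m \<nu> k (map c ts) = Some y)"

text \<open>
  \<open>M\<close> is the convolution of \<open>N\<close> formal sums \<open>rs\<close> with polyadic powers \<open>ln\<close> and \<open>lg\<close>: each \<open>N\<close>-tuple
  \<open>gs\<close> of elements of \<open>G\<close> yields a term with coefficient \<open>c gs\<close> at the group element \<open>h gs\<close>, where the
  \<open>i\<close>-th factor supplies \<open>(rs ! i) (gs ! i)\<close> as the \<open>i\<close>-th argument of the power of \<open>\<mu>\<close> and \<open>gs ! i\<close> as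
  the \<open>i\<close>-th argument of the power of \<open>\<mu>G\<close>. Both powers have to be defined on these arguments.
\<close>

definition is_convolution ::
  "'r set \<Rightarrow> nat \<Rightarrow> ('r list \<Rightarrow> 'r) \<Rightarrow> nat \<Rightarrow> ('r list \<Rightarrow> 'r) \<Rightarrow>
   'g set \<Rightarrow> nat \<Rightarrow> ('g list \<Rightarrow> 'g) \<Rightarrow> nat \<Rightarrow> nat \<Rightarrow>
   nat \<Rightarrow> (('g \<Rightarrow> 'r) list \<Rightarrow> 'g \<Rightarrow> 'r) \<Rightarrow> bool" where
  "is_convolution R m \<nu> n \<mu> G ng \<mu>G ln lg N M \<longleftrightarrow>
     (\<forall>rs \<in> nlists N (formal_sums R m \<nu> n \<mu> G). \<exists>c h.
        (\<forall>gs \<in> nlists N G.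
           polyadic_power n \<mu> ln (map2 (\<lambda>r g. r g) rs gs) = Some (c gs) \<and>
           polyadic_power ng \<mu>G lg gs = Some (h gs)) \<and>
        (\<forall>u\<in>G. gathers_to R m \<nu> n \<mu> {gs \<in> nlists N G. h gs = u} c (M rs u)))"

end

theory Submission
  imports Defs
begin

text \<open>
  The whole content of the theorem is that a composition of \<open>l\<close> copies of an $n$-ary operation
  takes exactly \<open>l * (n - 1) + 1\<close> arguments: each copy consumes \<open>n\<close> arguments and returns one
  (lemma \<open>length_eq_if_polyadic_power_eq_Some\<close>). In a convolution both powers are applied to
  \<open>N\<close> arguments, so \<open>N\<close> equals both counts. The one thing to check is that the convolution is
  not a vacuous condition, that is, that some term actually occurs in some product. \<open>G\<close> is
  nonempty, and so is the set of formal sums: a constant family is a formal sum, provided that its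
  value is the polyadic zero if there is one (lemma \<open>formal_sums_nonempty\<close>).
\<close>

text \<open>
  Replacing the first \<open>n\<close> arguments by their value under \<open>f\<close> shortens the list by \<open>n - 1\<close>, and
  after \<open>l\<close> such steps a single argument must remain.
\<close>

lemma length_eq_if_polyadic_power_eq_Some:
  assumes "polyadic_power n f l xs = Some y" and "n \<ge> 1"
  shows "length xs = l * (n - 1) + 1"
  using assms
proof (induction l arbitrary: xs)
  case 0
  then show ?case by (auto split: list.splits)
next
  case (Suc l)
  then have "n \<le> length xs"
    and "polyadic_power n f l (f (take n xs) # drop n xs) = Some y"
    by (auto split: if_splits)
  with Suc.IH[of "f (take n xs) # drop n xs"] \<open>n \<ge> 1\<close> show ?case by simp
qed

text \<open>
  With two zeros among its arguments, a product has to equal both of them.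
\<close>

lemma polyadic_zero_unique:
  assumes "polyadic_zero R m \<nu> n \<mu> z" and "polyadic_zero R m \<nu> n \<mu> z'" and "n \<ge> 2"
  shows "z = z'"
proof -
  let ?rs = "z # replicate (n - 1) z'"
  have "z \<in> R" "z' \<in> R"
    using assms(1,2) by (simp_all only: polyadic_zero_def)
  then have rs: "?rs \<in> nlists n R"
    using \<open>n \<ge> 2\<close> by (intro nlistsI) auto
  have "z \<in> set ?rs" "z' \<in> set ?rs"
    using \<open>n \<ge> 2\<close> by auto
  with rs have "\<mu> ?rs = z" "\<mu> ?rs = z'"
    using assms(1,2) unfolding polyadic_zero_def by blast+
  then show ?thesis by simp
qed

lemma formal_sums_nonempty:
  assumes "R \<noteq> {}" and "n \<ge> 2"
  shows "formal_sums R m \<nu> n \<mu> G \<noteq> {}"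
proof -
  have "\<exists>a\<in>R. \<forall>z. polyadic_zero R m \<nu> n \<mu> z \<longrightarrow> z = a"
  proof (cases "\<exists>z. polyadic_zero R m \<nu> n \<mu> z")
    case True
    then obtain z where z: "polyadic_zero R m \<nu> n \<mu> z" ..
    then have "z \<in> R"
      by (simp only: polyadic_zero_def)
    then show ?thesis
      using polyadic_zero_unique[OF _ z \<open>n \<ge> 2\<close>] by blast
  next
    case False
    then show ?thesis using \<open>R \<noteq> {}\<close> by blast
  qed
  then obtain a where "a \<in> R" and a: "\<And>z. polyadic_zero R m \<nu> n \<mu> z \<Longrightarrow> z = a"
    by blast
  have "finite {g \<in> G. (\<lambda>g\<in>G. a) g \<noteq> z}" if "polyadic_zero R m \<nu> n \<mu> z" for z
  proof -
    have "{g \<in> G. (\<lambda>g\<in>G. a) g \<noteq> z} = {}"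
      using a[OF that] by auto
    then show ?thesis by (simp only: finite.emptyI)
  qed
  moreover have "(\<lambda>g\<in>G. a) \<in> G \<rightarrow>\<^sub>E R"
    using \<open>a \<in> R\<close> by simp
  ultimately have "(\<lambda>g\<in>G. a) \<in> formal_sums R m \<nu> n \<mu> G"
    unfolding formal_sums_def by blast
  then show ?thesis by blast
qed

theorem theorem4p11:
  fixes R :: "'r set" and m_r n_r :: nat and \<nu> \<mu> :: "'r list \<Rightarrow> 'r"
    and G :: "'g set" and n_g :: nat and \<mu>G :: "'g list \<Rightarrow> 'g"
    and S :: "('g \<Rightarrow> 'r) set" and l_n l_g N :: nat
    and M :: "('g \<Rightarrow> 'r) list \<Rightarrow> ('g \<Rightarrow> 'r)"
  assumes "polyadic_ring R m_r \<nu> n_r \<mu>"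
    and "nary_group G n_g \<mu>G"
    and "(\<nexists>z. polyadic_zero R m_r \<nu> n_r \<mu> z) \<Longrightarrow> finite G"
    and "S = formal_sums R m_r \<nu> n_r \<mu> G"
    and "l_n \<ge> 1" and "l_g \<ge> 1"
    and "nary_operation S N M"
    and "is_convolution R m_r \<nu> n_r \<mu> G n_g \<mu>G l_n l_g N M"
  shows "N = l_n * (n_r - 1) + 1 \<and> l_n * (n_r - 1) + 1 = l_g * (n_g - 1) + 1"
proof -
  interpret R: polyadic_ring R m_r \<nu> n_r \<mu> by fact
  interpret G: nary_group G n_g \<mu>G by fact
  obtain g where "g \<in> G" using G.nonempty by blast
  obtain s where "s \<in> formal_sums R m_r \<nu> n_r \<mu> G"
    using formal_sums_nonempty[OF R.mult.nonempty R.mult.arity_ge_2] by blast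
  define gs where "gs = replicate N g"
  define ss where "ss = replicate N s"
  have "gs \<in> nlists N G"
    unfolding gs_def using \<open>g \<in> G\<close> by (rule nlists_replicateI)
  have "ss \<in> nlists N (formal_sums R m_r \<nu> n_r \<mu> G)"
    unfolding ss_def using \<open>s \<in> formal_sums R m_r \<nu> n_r \<mu> G\<close> by (rule nlists_replicateI)
  with \<open>gs \<in> nlists N G\<close> obtain x y where
      x: "polyadic_power n_r \<mu> l_n (map2 (\<lambda>r g. r g) ss gs) = Some x" and
      y: "polyadic_power n_g \<mu>G l_g gs = Some y"
    using assms(8) unfolding is_convolution_def by blast
  have "length (map2 (\<lambda>r g. r g) ss gs) = l_n * (n_r - 1) + 1"
    using length_eq_if_polyadic_power_eq_Some[OF x] R.mult.arity_ge_2 by linarith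
  moreover have "length gs = l_g * (n_g - 1) + 1"
    using length_eq_if_polyadic_power_eq_Some[OF y] G.arity_ge_2 by linarith
  ultimately show ?thesis by (simp add: gs_def ss_def)
qed

end
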